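(* Let $\mathbb{F}_q$ be a finite field with $q \equiv -1 \pmod 3$ and let $E$ be an elliptic curve over $\mathbb{F}_q$ possessing an $\mathbb{F}_q$-rational point of order $3$. Then, besides the subgroup generated by this point, $E$ has another rational subgroup of order $3$, whose nonzero points are not defined over $\mathbb{F}_q$.
   Context: A subgroup $G\subset E(\overline{\mathbb{F}}_q)$ is called rational (over $\mathbb{F}_q$) if it is stable, as a set, under the $q$-power Frobenius map $(x,y)\mapsto(x^q,y^q)$; its individual points need not be defined over $\mathbb{F}_q$. *)

theory Defs
  imports
    "HOL-Algebra.Algebraic_Closure_Type"
    "HOL-Algebra.Generated_Groups"
    "HOL-Number_Theory.Cong"
    "HOL-Library.Cardinality"
begin

text \<open>
  \<open>Weierstrass a1 a2 a3 a4 a6\<close> is the projective plane curve with affine equation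
  \<open>y^2 + a1 x y + a3 y = x^3 + a2 x^2 + a4 x + a6\<close>. The general (long) form is needed
  because characteristic 2 is not excluded.
\<close>

datatype 'a weierstrass = Weierstrass (a1: 'a) (a2: 'a) (a3: 'a) (a4: 'a) (a6: 'a)

datatype 'a ec_point = Infinity | Affine 'a 'a

definition on_curve :: "'a::field weierstrass \<Rightarrow> 'a \<Rightarrow> 'a \<Rightarrow> bool" where
  "on_curve E x y \<longleftrightarrow>
     y^2 + a1 E * x * y + a3 E * y = x^3 + a2 E * x^2 + a4 E * x + a6 E"

definition ec_points :: "'a::field weierstrass \<Rightarrow> 'a ec_point set" where
  "ec_points E = insert Infinity {Affine x y | x y. on_curve E x y}"

text \<open>Both partial derivatives of the Weierstrass equation vanish at \<open>(x, y)\<close>.\<close>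

definition singular_point :: "'a::field weierstrass \<Rightarrow> 'a \<Rightarrow> 'a \<Rightarrow> bool" where
  "singular_point E x y \<longleftrightarrow> on_curve E x y \<and>
     a1 E * y - (3 * x^2 + 2 * a2 E * x + a4 E) = 0 \<and> 2 * y + a1 E * x + a3 E = 0"

abbreviation closure_curve :: "'a::field weierstrass \<Rightarrow> 'a alg_closure weierstrass" where
  "closure_curve \<equiv> map_weierstrass to_ac"

text \<open>
  Smoothness is geometric, i.e. tested over the algebraic closure. The point at infinity of a
  Weierstrass cubic is always smooth, so only affine points have to be considered.
\<close>

definition elliptic_curve :: "'a::field weierstrass \<Rightarrow> bool" where
  "elliptic_curve E \<longleftrightarrow> (\<nexists>x y. singular_point (closure_curve E) x y)"

text \<open>
  Chord-tangent addition: \<open>y = l x + (y1 - l x1)\<close> is the line through the two points, or the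
  tangent if they coincide. The first case of the conditional says that the points are
  opposite to each other; given equal \<open>x\<close>-coordinates and that this case does not
  apply, two points of the curve are equal.
\<close>

fun ec_add :: "'a::field weierstrass \<Rightarrow> 'a ec_point \<Rightarrow> 'a ec_point \<Rightarrow> 'a ec_point" where
  "ec_add E Infinity Q = Q"
| "ec_add E P Infinity = P"
| "ec_add E (Affine x1 y1) (Affine x2 y2) =
     (if x1 = x2 \<and> y1 + y2 + a1 E * x2 + a3 E = 0 then Infinity
      else
        let l = (if x1 = x2
                 then (3 * x1^2 + 2 * a2 E * x1 + a4 E - a1 E * y1) / (2 * y1 + a1 E * x1 + a3 E)
                 else (y2 - y1) / (x2 - x1));
            x3 = l^2 + a1 E * l - a2 E - x1 - x2;
            y3 = - (l + a1 E) * x3 - (y1 - l * x1) - a3 E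
        in Affine x3 y3)"

definition ec_group :: "'a::field weierstrass \<Rightarrow> 'a ec_point monoid" where
  "ec_group E = \<lparr>carrier = ec_points E, monoid.mult = ec_add E, one = Infinity\<rparr>"

text \<open>
  The group of points of \<open>E\<close> over the algebraic closure of the base field, and inside it
  the set of points defined over the base field.
\<close>

abbreviation geometric_group :: "'a::field weierstrass \<Rightarrow> 'a alg_closure ec_point monoid" where
  "geometric_group E \<equiv> ec_group (closure_curve E)"

definition rational_points :: "'a::field weierstrass \<Rightarrow> 'a alg_closure ec_point set" where
  "rational_points E = map_ec_point to_ac ` ec_points E"

text \<open>The order of an element, stated without reference to the locale \<open>group\<close>.\<close>

definition element_order :: "('a, 'b) monoid_scheme \<Rightarrow> 'a \<Rightarrow> nat \<Rightarrow> bool" where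
  "element_order G x n \<longleftrightarrow> n > 0 \<and> x [^]\<^bsub>G\<^esub> n = \<one>\<^bsub>G\<^esub> \<and>
     (\<forall>m. 0 < m \<and> m < n \<longrightarrow> x [^]\<^bsub>G\<^esub> m \<noteq> \<one>\<^bsub>G\<^esub>)"

text \<open>Here the base field \<open>'a\<close> has \<open>q = CARD('a)\<close> elements.\<close>

definition frobenius ::
  "'a::{field,finite} alg_closure ec_point \<Rightarrow> 'a alg_closure ec_point" where
  "frobenius = map_ec_point (\<lambda>x. x ^ CARD('a))"

definition rational_subgroup ::
  "'a::{field,finite} weierstrass \<Rightarrow> 'a alg_closure ec_point set \<Rightarrow> bool" where
  "rational_subgroup E H \<longleftrightarrow> subgroup H (geometric_group E) \<and> frobenius ` H = H"

end

theory Submission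
  imports Defs
begin

text \<open>
  A point \<open>P\<close> of order 3 is a flex. Taking \<open>P\<close> as origin and its tangent as first axis, the curve
  becomes \<open>Y^2 + A X Y + B Y = X^3\<close>, and apart from \<open>X = 0\<close> the abscissas of the points of order 3
  are the roots of \<open>3 X^3 + A^2 X^2 + 3 A B X + 3 B^2\<close>. The substitution \<open>X = B / k\<close> turns this
  cubic into \<open>(A + 3 k)^3 = A^3 - 27 B\<close>, which has a solution \<open>k\<close> in the base field since cubing
  is bijective for \<open>q \<equiv> 2 (mod 3)\<close>. The two points above the resulting abscissa have ordinates
  \<open>a + b w\<close> with \<open>a, b\<close> in the base field and \<open>w\<close> a primitive cube root of unity.
  As \<open>w^q = w^2\<close>, Frobenius swaps them; they are distinct because \<open>b = 0\<close> would
  make the curve singular there.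
\<close>

section \<open>Finite fields\<close>

text \<open>Multiplication by a nonzero \<open>x\<close> permutes the nonzero elements; comparing
  their products gives \<open>x ^ (q - 1) = 1\<close>.\<close>

lemma power_card_eq_same:
  fixes x :: "'a::{field,finite}"
  shows "x ^ CARD('a) = x"
proof (cases "x = 0")
  case False
  have "x ^ (CARD('a) - 1) * \<Prod>(UNIV-{0}) = (\<Prod>y\<in>UNIV-{0}. x * y)"
    by (simp add: prod.distrib)
  also have "\<dots> = \<Prod>(UNIV-{0})"
    by (rule prod.reindex_bij_witness[of _ "\<lambda>y. y / x" "\<lambda>y. x * y"]) (use False in auto)
  finally have "x ^ (CARD('a) - 1) = 1"
    by simp
  then show ?thesis
    using finite_UNIV_card_ge_0[where ?'a = 'a] by (metis finite mult.right_neutral power_eq_if not_gr_zero)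
qed simp

lemma cube_root_exists:
  fixes a :: "'a::{field,finite}"
  assumes "CARD('a) mod 3 = 2"
  shows "\<exists>c. c ^ 3 = a"
proof (cases "a = 0")
  case False
  define k where "k = CARD('a) div 3"
  have q: "CARD('a) = 3 * k + 2"
    using assms unfolding k_def by presburger
  \<comment> \<open>The exponent is chosen so that \<open>3 * (2 * k + 1) = 2 * q - 1\<close>, hence
    the cube is \<open>a ^ (2 * q - 1) = a\<close>.\<close>
  have "a * (a ^ (2 * k + 1)) ^ 3 = a ^ (1 + (2 * k + 1) * 3)"
    by (simp only: power_add power_mult power_one_right)
  also have "1 + (2 * k + 1) * 3 = CARD('a) + CARD('a)"
    unfolding q by simp
  also have "a ^ (CARD('a) + CARD('a)) = a ^ CARD('a) * a ^ CARD('a)"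
    by (rule power_add)
  also have "\<dots> = a * a"
    by (simp only: power_card_eq_same)
  finally show ?thesis
    using False by auto
qed auto

text \<open>Translation by 1 permutes the field, so summing over it gives \<open>q = 0\<close>
  there; were \<open>3 = 0\<close>, then \<open>q = 3 * k + 2\<close> would give
  \<open>2 = 0\<close> as well.\<close>

lemma three_neq_zero:
  assumes "CARD('a::{field,finite}) mod 3 = 2"
  shows "(3::'a) \<noteq> 0"
proof
  assume three: "(3::'a) = 0"
  define k where "k = CARD('a) div 3"
  have q: "CARD('a) = 3 * k + 2"
    using assms unfolding k_def by presburger
  have "(\<Sum>x\<in>UNIV. x + 1 :: 'a) = (\<Sum>x\<in>UNIV. x)"
    by (rule sum.reindex_bij_witness[of _ "\<lambda>x. x - 1" "\<lambda>x. x + 1"]) auto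
  then have "of_nat CARD('a) = (0::'a)"
    by (simp add: sum.distrib)
  then have "(2::'a) = 0"
    unfolding q by (simp add: three)
  with three show False
    by (metis add_cancel_left_right numeral_Bit1 numeral_Bit0 zero_neq_one one_add_one add_0 numeral_One)
qed

text \<open>
  Used twice, this extends additivity of the \<open>q\<close>-power map from the base field to its closure,
  without knowing that \<open>q\<close> is a power of the characteristic.
\<close>

lemma power_add_if_many_points:
  fixes y z :: "'k::idom"
  assumes "\<And>w. w \<in> S \<Longrightarrow> (y + w) ^ n = y ^ n + w ^ n" and "n \<le> card S" and "n > 0"
  shows "(y + z) ^ n = y ^ n + z ^ n"
proof -
  \<comment> \<open>Both sides have degree at most \<open>n\<close> and agree in the coefficient at
    \<open>n\<close>, so \<open>n\<close> common values suffice instead of \<open>n + 1\<close>. The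
    base field offers exactly \<open>q\<close>.\<close>
  have "[:y, 1:] ^ n - [:y ^ n:] = monom 1 n"
  proof (rule poly_eqI_degree_lead_coeff[where n = n and A = S])
    show "degree ([:y, 1:] ^ n - [:y ^ n:]) \<le> n"
      by (intro degree_diff_le) (auto simp: degree_linear_power)
    show "coeff ([:y, 1:] ^ n - [:y ^ n:]) n = coeff (monom 1 n) n"
      using \<open>n > 0\<close> by (simp add: coeff_linear_power coeff_pCons split: nat.split)
  qed (use assms in \<open>auto simp: poly_monom degree_monom_eq\<close>)
  then have "poly ([:y, 1:] ^ n - [:y ^ n:]) z = poly (monom 1 n) z"
    by simp
  then show ?thesis
    by (simp add: poly_monom algebra_simps)
qed

lemma frobenius_add:
  fixes y z :: "'a::{field,finite} alg_closure"
  shows "(y + z) ^ CARD('a) = y ^ CARD('a) + z ^ CARD('a)"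
proof -
  have card: "CARD('a) \<le> card (range (to_ac :: 'a \<Rightarrow> _))"
    by (simp add: card_image inj_to_ac)
  have base: "(to_ac a + w) ^ CARD('a) = to_ac a ^ CARD('a) + w ^ CARD('a)" for a :: 'a and w
  proof (rule power_add_if_many_points[OF _ card])
    fix w :: "'a alg_closure"
    assume "w \<in> range to_ac"
    then obtain b where "w = to_ac b" by blast
    then show "(to_ac a + w) ^ CARD('a) = to_ac a ^ CARD('a) + w ^ CARD('a)"
      by (simp add: power_card_eq_same flip: to_ac_add to_ac_power)
  qed simp
  show ?thesis
    by (rule power_add_if_many_points[OF _ card]) (auto simp: base add.commute[of y])
qed

section \<open>Subgroups of order three\<close>

lemma opposite_ordinate_iff:
  fixes y y' a b :: "'k::field"
  shows "y + y' + a + b = 0 \<longleftrightarrow> y' = - y - a - b"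
proof -
  have "y + y' + a + b = y' - (- y - a - b)"
    by simp
  then show ?thesis
    by (simp only: right_minus_eq)
qed

lemma ec_add_eq_Infinity_iff:
  "ec_add E (Affine x y) Q = Infinity \<longleftrightarrow> Q = Affine x (- y - a1 E * x - a3 E)"
proof (cases Q)
  case (Affine x' y')
  have "y + y' + a1 E * x + a3 E = 0 \<longleftrightarrow> y' = - y - a1 E * x - a3 E"
    by (rule opposite_ordinate_iff)
  then show ?thesis
    using Affine by (auto simp: Let_def)
qed auto

lemma inv_ec_group_Infinity: "inv\<^bsub>ec_group E\<^esub> Infinity = Infinity"
  unfolding m_inv_def by (rule the_equality) (auto simp: ec_group_def ec_points_def)

text \<open>\<open>m_inv\<close> is a definite description; \<open>ec_add_eq_Infinity_iff\<close>
  leaves a single candidate for it.\<close>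

lemma inv_ec_group_Affine:
  assumes "on_curve E x y" and "on_curve E x y'" and "y + y' + a1 E * x + a3 E = 0"
  shows "inv\<^bsub>ec_group E\<^esub> (Affine x y) = Affine x y'"
proof -
  have y': "y' = - y - a1 E * x - a3 E"
    using assms(3) unfolding opposite_ordinate_iff .
  show ?thesis
    unfolding m_inv_def
  proof (rule the_equality)
    show "Affine x y' \<in> carrier (ec_group E) \<and> Affine x y \<otimes>\<^bsub>ec_group E\<^esub> Affine x y' = \<one>\<^bsub>ec_group E\<^esub> \<and>
          Affine x y' \<otimes>\<^bsub>ec_group E\<^esub> Affine x y = \<one>\<^bsub>ec_group E\<^esub>"
      using assms by (auto simp: ec_group_def ec_points_def ec_add_eq_Infinity_iff y' simp del: ec_add.simps)
  qed (auto simp: ec_group_def ec_add_eq_Infinity_iff y' simp del: ec_add.simps)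
qed

text \<open>The doubling equations say \<open>2 T = - T\<close> for both nonzero points; with
  \<open>opp\<close> they complete the addition table of a cyclic group of order 3.\<close>

lemma subgroup_order_three:
  assumes "on_curve E x y" and "on_curve E x y'" and opp: "y + y' + a1 E * x + a3 E = 0"
    and "ec_add E (Affine x y) (Affine x y) = Affine x y'"
    and "ec_add E (Affine x y') (Affine x y') = Affine x y"
  shows "subgroup {Infinity, Affine x y, Affine x y'} (ec_group E)"
proof -
  have opp': "y' + y + a1 E * x + a3 E = 0"
    using opp by (simp add: add.commute)
  have sum: "ec_add E (Affine x y) (Affine x y') = Infinity"
    "ec_add E (Affine x y') (Affine x y) = Infinity"
    using opp opp' by auto
  have inv: "inv\<^bsub>ec_group E\<^esub> (Affine x y) = Affine x y'" "inv\<^bsub>ec_group E\<^esub> (Affine x y') = Affine x y"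
    using assms opp' by (auto intro: inv_ec_group_Affine)
  have sum_Infinity: "ec_add E Q Infinity = Q" for Q
    by (cases Q) auto
  show ?thesis
  proof
    show "{Infinity, Affine x y, Affine x y'} \<subseteq> carrier (ec_group E)"
      using assms by (auto simp: ec_group_def ec_points_def)
    show "\<one>\<^bsub>ec_group E\<^esub> \<in> {Infinity, Affine x y, Affine x y'}"
      by (simp add: ec_group_def)
    show "inv\<^bsub>ec_group E\<^esub> Q \<in> {Infinity, Affine x y, Affine x y'}"
      if "Q \<in> {Infinity, Affine x y, Affine x y'}" for Q
      using that by (auto simp: inv inv_ec_group_Infinity)
    show "Q \<otimes>\<^bsub>ec_group E\<^esub> R \<in> {Infinity, Affine x y, Affine x y'}"
      if "Q \<in> {Infinity, Affine x y, Affine x y'}" "R \<in> {Infinity, Affine x y, Affine x y'}" for Q R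
      using that by (auto simp: ec_group_def sum sum_Infinity assms(4,5) simp del: ec_add.simps(3))
  qed
qed

text \<open>Order 3 means that \<open>2 T\<close> is the opposite of \<open>T\<close>, so its
  abscissa is \<open>x\<close> again; the addition formula turns this into triple contact of the
  tangent at \<open>T\<close>.\<close>

lemma order_three_imp_flex:
  assumes "element_order (ec_group E) (Affine x y) 3"
    and "l = (3 * x^2 + 2 * a2 E * x + a4 E - a1 E * y) / (2 * y + a1 E * x + a3 E)"
  shows "2 * y + a1 E * x + a3 E \<noteq> 0" and "l^2 + a1 E * l - a2 E = 3 * x"
proof -
  define T where "T = Affine x y"
  have pow: "T [^]\<^bsub>ec_group E\<^esub> (Suc (Suc 0)) = ec_add E T T"
    "T [^]\<^bsub>ec_group E\<^esub> (Suc (Suc (Suc 0))) = ec_add E (ec_add E T T) T"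
    by (simp_all add: nat_pow_def ec_group_def)
  have two: "ec_add E T T \<noteq> Infinity" and three: "ec_add E (ec_add E T T) T = Infinity"
    using assms(1) unfolding element_order_def T_def[symmetric] pow[symmetric]
    by (auto simp: numeral_3_eq_3 ec_group_def)
  show B: "2 * y + a1 E * x + a3 E \<noteq> 0"
    using two by (auto simp: T_def simp flip: mult_2)
  obtain x' y' where double: "ec_add E T T = Affine x' y'"
    using two by (cases "ec_add E T T") auto
  have "x' = x"
    using three unfolding double unfolding T_def ec_add_eq_Infinity_iff by simp
  moreover have "x' = l^2 + a1 E * l - a2 E - x - x"
    using double B assms(2) unfolding T_def by (simp add: Let_def flip: mult_2)
  ultimately have "l^2 + a1 E * l - a2 E = x + x + x"
    by (simp only: diff_eq_eq)
  then show "l^2 + a1 E * l - a2 E = 3 * x"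
    by simp
qed

section \<open>The conjugate points of order three\<close>

text \<open>
  \<open>l\<close> is the slope of the tangent at the flex \<open>(x0, y0)\<close>. The parameters satisfy \<open>B = 3 k m\<close>, so the
  abscissa \<open>B / k\<close> in the chart centred at the flex is \<open>3 m\<close>; the equation relating \<open>A\<close>, \<open>k\<close>, \<open>m\<close> is
  \<open>(A + 3 k)^3 = A^3 - 27 B\<close> divided by \<open>9 k\<close>.
\<close>

locale flex =
  fixes E :: "'k::field weierstrass" and x0 y0 l A k m w :: 'k
  assumes curve: "on_curve E x0 y0"
    and A: "A = a1 E + 2 * l" and B: "2 * y0 + a1 E * x0 + a3 E = 3 * k * m"
    and slope: "3 * x0^2 + 2 * a2 E * x0 + a4 E - a1 E * y0 = l * (3 * k * m)"
    and inflection: "l^2 + a1 E * l - a2 E = 3 * x0"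
    and km: "9 * m + A^2 + 3 * A * k + 3 * k^2 = 0"
    and w: "w^2 + w + 1 = 0"
begin

text \<open>In the chart \<open>X = x - x0\<close>, \<open>Y = y - y0 - l * X\<close> this is the
  point \<open>X = 3 * m\<close>, \<open>Y = conj_v * w - m * A\<close>. Replacing \<open>w\<close>
  by the other root \<open>- 1 - w\<close> gives the opposite point.\<close>

definition "conj_x = x0 + 3 * m"
definition "conj_v = m * (A + 3 * k)"
definition "conj_y = y0 + 3 * l * m - m * A + conj_v * w"

text \<open>Eliminating the coefficients reduces the claims below to polynomial identities in the
  parameters. Where needed, the difference of the two sides is written as an explicit combination of
  the left sides of \<open>km\<close> and \<open>w\<close>.\<close>

lemma coefficients:
  "a1 E = A - 2 * l"
  "a2 E = l^2 + (A - 2 * l) * l - 3 * x0"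
  "a3 E = 3 * k * m - 2 * y0 - (A - 2 * l) * x0"
  "a4 E = l * (3 * k * m) - 3 * x0^2 - 2 * (l^2 + (A - 2 * l) * l - 3 * x0) * x0 + (A - 2 * l) * y0"
  "a6 E = y0^2 + (A - 2 * l) * x0 * y0 + (3 * k * m - 2 * y0 - (A - 2 * l) * x0) * y0 - x0^3
     - (l^2 + (A - 2 * l) * l - 3 * x0) * x0^2
     - (l * (3 * k * m) - 3 * x0^2 - 2 * (l^2 + (A - 2 * l) * l - 3 * x0) * x0 + (A - 2 * l) * y0) * x0"
proof -
  show a1: "a1 E = A - 2 * l"
    using A by simp
  show a2: "a2 E = l^2 + (A - 2 * l) * l - 3 * x0"
    using inflection unfolding a1 by (simp add: algebra_simps)
  show a3: "a3 E = 3 * k * m - 2 * y0 - (A - 2 * l) * x0"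
    using B unfolding a1 by (simp add: algebra_simps)
  show a4: "a4 E = l * (3 * k * m) - 3 * x0^2 - 2 * (l^2 + (A - 2 * l) * l - 3 * x0) * x0 + (A - 2 * l) * y0"
    using slope unfolding a1 a2 by (simp add: algebra_simps)
  show "a6 E = y0^2 + (A - 2 * l) * x0 * y0 + (3 * k * m - 2 * y0 - (A - 2 * l) * x0) * y0 - x0^3
     - (l^2 + (A - 2 * l) * l - 3 * x0) * x0^2
     - (l * (3 * k * m) - 3 * x0^2 - 2 * (l^2 + (A - 2 * l) * l - 3 * x0) * x0 + (A - 2 * l) * y0) * x0"
    using curve unfolding on_curve_def a1 a2 a3 a4 by (simp add: algebra_simps)
qed

lemma on_curve_conj: "on_curve E conj_x conj_y"
proof -
  have "conj_y^2 + a1 E * conj_x * conj_y + a3 E * conj_y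
      - (conj_x^3 + a2 E * conj_x^2 + a4 E * conj_x + a6 E) =
    m^2 * ((w^2 + w + 1) * (A + 3 * k)^2 - 3 * (9 * m + A^2 + 3 * A * k + 3 * k^2))"
    unfolding coefficients conj_x_def conj_y_def conj_v_def
    by (simp add: algebra_simps power2_eq_square power3_eq_cube)
  then show ?thesis
    unfolding on_curve_def km w by simp
qed

lemma conj_denominator: "2 * conj_y + a1 E * conj_x + a3 E = conj_v * (2 * w + 1)"
  unfolding coefficients conj_x_def conj_y_def conj_v_def by (simp add: algebra_simps)

text \<open>The first factor on the right is the tangent slope at the new point, the second its
  denominator by \<open>conj_denominator\<close>. The product form still applies when
  \<open>conj_v = 0\<close>, as in \<open>singular_conj\<close>.\<close>

lemma conj_slope:
  "3 * conj_x^2 + 2 * a2 E * conj_x + a4 E - a1 E * conj_y =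
    (l + A * w + k * (2 * w + 1)) * (conj_v * (2 * w + 1))"
proof -
  have "3 * conj_x^2 + 2 * a2 E * conj_x + a4 E - a1 E * conj_y
      - (l + A * w + k * (2 * w + 1)) * (conj_v * (2 * w + 1)) =
    m * (3 * (9 * m + A^2 + 3 * A * k + 3 * k^2) - 2 * (A + 3 * k) * (A + 2 * k) * (w^2 + w + 1))"
    unfolding coefficients conj_x_def conj_y_def conj_v_def
    by (simp add: algebra_simps power2_eq_square power3_eq_cube)
  then show ?thesis
    unfolding km w by simp
qed

text \<open>This is \<open>inflection\<close> at the new point, which is thus a flex too: its
  tangent meets the curve only over \<open>conj_x\<close>, so in \<open>double_conj\<close> doubling
  yields the opposite point.\<close>

lemma conj_inflection:
  "(l + A * w + k * (2 * w + 1))^2 + a1 E * (l + A * w + k * (2 * w + 1)) - a2 E = 3 * conj_x"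
proof -
  have "(l + A * w + k * (2 * w + 1))^2 + a1 E * (l + A * w + k * (2 * w + 1)) - a2 E - 3 * conj_x =
    (w^2 + w + 1) * (A + 2 * k)^2 - (9 * m + A^2 + 3 * A * k + 3 * k^2)"
    unfolding coefficients conj_x_def
    by (simp add: algebra_simps power2_eq_square power3_eq_cube)
  then show ?thesis
    unfolding km w by simp
qed

lemma double_conj:
  assumes "conj_v * (2 * w + 1) \<noteq> 0"
  shows "ec_add E (Affine conj_x conj_y) (Affine conj_x conj_y) =
    Affine conj_x (- conj_y - a1 E * conj_x - a3 E)"
proof -
  define s where "s = l + A * w + k * (2 * w + 1)"
  have s: "(3 * conj_x^2 + 2 * a2 E * conj_x + a4 E - a1 E * conj_y) / (2 * conj_y + a1 E * conj_x + a3 E) = s"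
    unfolding conj_denominator conj_slope s_def using assms by simp
  have D: "conj_y + conj_y + a1 E * conj_x + a3 E \<noteq> 0"
    unfolding mult_2[symmetric] conj_denominator by (fact assms)
  have x3: "s^2 + a1 E * s - a2 E - conj_x - conj_x = conj_x"
    using conj_inflection unfolding s_def[symmetric] by simp
  have "ec_add E (Affine conj_x conj_y) (Affine conj_x conj_y) =
      Affine conj_x (- (s + a1 E) * conj_x - (conj_y - s * conj_x) - a3 E)"
    using D by (simp only: ec_add.simps Let_def s x3 simp_thms if_True if_False)
  also have "- (s + a1 E) * conj_x - (conj_y - s * conj_x) - a3 E = - conj_y - a1 E * conj_x - a3 E"
    by (simp add: algebra_simps)
  finally show ?thesis .
qed

text \<open>Both partial derivatives contain the factor \<open>conj_v\<close>, so smoothness will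
  force \<open>conj_v\<close> to be nonzero.\<close>

lemma singular_conj:
  assumes "conj_v = 0"
  shows "singular_point E conj_x conj_y"
  using on_curve_conj conj_slope conj_denominator assms
  unfolding singular_point_def by (simp add: algebra_simps)

end

lemma flex_parameters_exist:
  fixes A B :: "'a::{field,finite}"
  assumes q: "CARD('a) mod 3 = 2" and "B \<noteq> 0"
  obtains k m where "B = 3 * k * m" and "9 * m + A^2 + 3 * A * k + 3 * k^2 = 0"
proof -
  have three: "(3::'a) \<noteq> 0"
    using q by (rule three_neq_zero)
  obtain c where c: "c^3 = A^3 - 27 * B"
    using cube_root_exists[OF q] by blast
  define k where "k = (c - A) / 3"
  define m where "m = B / (3 * k)"
  have c_eq: "c = A + 3 * k"
    by (simp only: k_def times_divide_eq_right nonzero_mult_div_cancel_left[OF three]) simp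
  have "(27::'a) = 3 * 3 * 3"
    by simp
  then have "(27::'a) \<noteq> 0"
    using three by (metis mult_eq_0_iff)
  \<comment> \<open>For \<open>k = 0\<close> the cube root \<open>c\<close> would equal
    \<open>A\<close>, forcing \<open>27 * B = 0\<close>.\<close>
  then have "k \<noteq> 0"
    using c \<open>B \<noteq> 0\<close> unfolding c_eq by auto
  then have B: "B = 3 * k * m"
    unfolding m_def using three by simp
  have "3 * 3 * k * (9 * m + A^2 + 3 * A * k + 3 * k^2) = (A + 3 * k)^3 - (A^3 - 27 * (3 * k * m))"
    by (simp add: algebra_simps power2_eq_square power3_eq_cube)
  also have "\<dots> = 0"
    using c unfolding c_eq B by simp
  finally have "9 * m + A^2 + 3 * A * k + 3 * k^2 = 0"
    using three \<open>k \<noteq> 0\<close> by (metis mult_eq_0_iff)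
  with B show thesis
    by (rule that)
qed

section \<open>Rationality\<close>

lemma on_curve_closure_curve [simp]:
  "on_curve (closure_curve E) (to_ac x) (to_ac y) \<longleftrightarrow> on_curve E x y"
proof -
  have "on_curve (closure_curve E) (to_ac x) (to_ac y) \<longleftrightarrow>
      to_ac (y^2 + a1 E * x * y + a3 E * y) = to_ac (x^3 + a2 E * x^2 + a4 E * x + a6 E)"
    unfolding on_curve_def by (simp add: weierstrass.map_sel)
  then show ?thesis
    unfolding to_ac_eq_iff on_curve_def .
qed

lemma frobenius_Affine: "frobenius (Affine x y :: 'a::{field,finite} alg_closure ec_point) =
    Affine (x ^ CARD('a)) (y ^ CARD('a))"
  by (simp add: frobenius_def)

lemma to_ac_power_card: "to_ac (a :: 'a::{field,finite}) ^ CARD('a) = to_ac a"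
  by (simp add: power_card_eq_same flip: to_ac_power)

lemma frobenius_rational_point:
  assumes "Q \<in> rational_points E"
  shows "frobenius Q = Q"
proof -
  obtain R where "Q = map_ec_point to_ac R"
    using assms unfolding rational_points_def by blast
  then show ?thesis
    by (cases R) (simp_all add: frobenius_def to_ac_power_card)
qed

text \<open>The order is measured over the closure, but the tangent slope is a quotient of base
  field elements, so injectivity of \<open>to_ac\<close> brings the flex equations down to the base
  field, where cube roots exist.\<close>

lemma rational_flex:
  fixes E :: "'a::field weierstrass"
  assumes "P \<in> rational_points E" and "element_order (geometric_group E) P 3"
  obtains x y l where "P = Affine (to_ac x) (to_ac y)" and "on_curve E x y"
    and "2 * y + a1 E * x + a3 E \<noteq> 0"
    and "3 * x^2 + 2 * a2 E * x + a4 E - a1 E * y = l * (2 * y + a1 E * x + a3 E)"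
    and "l^2 + a1 E * l - a2 E = 3 * x"
proof -
  have "P [^]\<^bsub>geometric_group E\<^esub> (1::nat) \<noteq> Infinity"
    using assms(2) unfolding element_order_def by (auto simp: ec_group_def)
  then have "P \<noteq> Infinity"
    by (auto simp: ec_group_def nat_pow_def)
  then obtain x y where P: "P = Affine (to_ac x) (to_ac y)" and xy: "on_curve E x y"
    using assms(1) by (auto simp: rational_points_def ec_points_def)
  define l where "l = (3 * x^2 + 2 * a2 E * x + a4 E - a1 E * y) / (2 * y + a1 E * x + a3 E)"
  note order = assms(2)[unfolded P]
  have "to_ac l = (3 * to_ac x^2 + 2 * a2 (closure_curve E) * to_ac x + a4 (closure_curve E) -
      a1 (closure_curve E) * to_ac y) / (2 * to_ac y + a1 (closure_curve E) * to_ac x + a3 (closure_curve E))"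
    unfolding l_def by (simp add: weierstrass.map_sel)
  from order_three_imp_flex[OF order this]
  have "to_ac (2 * y + a1 E * x + a3 E) \<noteq> to_ac 0" and "to_ac (l^2 + a1 E * l - a2 E) = to_ac (3 * x)"
    by (simp_all add: weierstrass.map_sel)
  then have B: "2 * y + a1 E * x + a3 E \<noteq> 0" and flex: "l^2 + a1 E * l - a2 E = 3 * x"
    unfolding to_ac_eq_iff by simp_all
  show thesis
    using that[OF P xy B _ flex] B unfolding l_def by simp
qed

text \<open>Since \<open>w^3 = 1\<close>, only \<open>n mod 3\<close> matters. For
  \<open>n = q\<close> this shows that Frobenius exchanges the two roots \<open>w\<close> and
  \<open>- 1 - w\<close>.\<close>

lemma primitive_cube_root_power:
  fixes w :: "'k::field"
  assumes "w^2 + w + 1 = 0" and "n mod 3 = 2"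
  shows "w ^ n = - 1 - w"
proof -
  have w2: "w^2 = - 1 - w"
    using assms(1) opposite_ordinate_iff[of 0 "w^2" w 1] by simp
  have "w^3 - 1 = (w - 1) * (w^2 + w + 1)"
    by (simp add: algebra_simps power2_eq_square power3_eq_cube)
  then have "w^3 = 1"
    using assms(1) by simp
  moreover have "n = 3 * (n div 3) + 2"
    using assms(2) by presburger
  ultimately have "w ^ n = w^2"
    by (metis mult_1 power_add power_mult power_one)
  with w2 show ?thesis
    by simp
qed

theorem mainTheorem1:
  fixes E :: "'a::{field,finite} weierstrass"
    and P :: "'a alg_closure ec_point"
  assumes "[int CARD('a) = -1] (mod 3)"
    and "elliptic_curve E"
    and "P \<in> rational_points E"
    and "element_order (geometric_group E) P 3"
  shows "\<exists>H. rational_subgroup E H \<and> card H = 3 \<and>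
             H \<noteq> generate (geometric_group E) {P} \<and>
             (\<forall>Q \<in> H - {Infinity}. Q \<notin> rational_points E)"
proof -
  have q: "CARD('a) mod 3 = 2"
    using assms(1) unfolding cong_def by presburger
  obtain x0 y0 l where P: "P = Affine (to_ac x0) (to_ac y0)" and curve: "on_curve E x0 y0"
    and B: "2 * y0 + a1 E * x0 + a3 E \<noteq> 0"
    and slope: "3 * x0^2 + 2 * a2 E * x0 + a4 E - a1 E * y0 = l * (2 * y0 + a1 E * x0 + a3 E)"
    and inflection: "l^2 + a1 E * l - a2 E = 3 * x0"
    using rational_flex[OF assms(3,4)] by blast
  define A where "A = a1 E + 2 * l"
  obtain k m where km: "2 * y0 + a1 E * x0 + a3 E = 3 * k * m"
    "9 * m + A^2 + 3 * A * k + 3 * k^2 = 0"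
    using flex_parameters_exist[OF q B] by blast
  obtain w :: "'a alg_closure" where "poly [:1, 1, 1:] w = 0"
    using alg_closed_imp_poly_has_root[of "[:1, 1, 1:] :: 'a alg_closure poly"] by auto
  then have w: "w^2 + w + 1 = 0"
    by (simp add: algebra_simps power2_eq_square)
  \<comment> \<open>Stated for an arbitrary root, because the locale is interpreted at both roots,
    one for each conjugate point.\<close>
  have flex: "flex (closure_curve E) (to_ac x0) (to_ac y0) (to_ac l) (to_ac A) (to_ac k) (to_ac m) w"
    if "w^2 + w + 1 = 0" for w
  proof
    show "on_curve (closure_curve E) (to_ac x0) (to_ac y0)"
      using curve by simp
    show "to_ac A = a1 (closure_curve E) + 2 * to_ac l"
      by (simp add: A_def weierstrass.map_sel)
    show "2 * to_ac y0 + a1 (closure_curve E) * to_ac x0 + a3 (closure_curve E) = 3 * to_ac k * to_ac m"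
      using arg_cong[OF km(1), of to_ac] by (simp add: weierstrass.map_sel)
    show "3 * (to_ac x0)^2 + 2 * a2 (closure_curve E) * to_ac x0 + a4 (closure_curve E)
        - a1 (closure_curve E) * to_ac y0 = to_ac l * (3 * to_ac k * to_ac m)"
      using arg_cong[OF slope[unfolded km(1)], of to_ac] by (simp add: weierstrass.map_sel)
    show "(to_ac l)^2 + a1 (closure_curve E) * to_ac l - a2 (closure_curve E) = 3 * to_ac x0"
      using arg_cong[OF inflection, of to_ac] by (simp add: weierstrass.map_sel)
    show "9 * to_ac m + (to_ac A)^2 + 3 * to_ac A * to_ac k + 3 * (to_ac k)^2 = 0"
      using arg_cong[OF km(2), of to_ac] by simp
  qed (fact that)
  define w' where "w' = - 1 - w"
  have w': "w'^2 + w' + 1 = 0"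
    using w unfolding w'_def by (simp add: algebra_simps power2_eq_square)
  interpret T: flex "closure_curve E" "to_ac x0" "to_ac y0" "to_ac l" "to_ac A" "to_ac k" "to_ac m" w
    using w by (rule flex)
  interpret T': flex "closure_curve E" "to_ac x0" "to_ac y0" "to_ac l" "to_ac A" "to_ac k" "to_ac m" w'
    using w' by (rule flex)
  \<comment> \<open>\<open>conj_x\<close> and \<open>conj_v\<close> do not involve \<open>w\<close>,
    so \<open>x\<close> and \<open>v\<close> serve both interpretations; only the ordinates
    differ.\<close>
  define x y y' v where "x = T.conj_x" and "y = T.conj_y" and "y' = T'.conj_y" and "v = T.conj_v"
  have "v \<noteq> 0"
    using T.singular_conj assms(2) unfolding elliptic_curve_def v_def by blast
  \<comment> \<open>The discriminant of \<open>w^2 + w + 1\<close> is -3, which is nonzero here, so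
    the two roots are distinct.\<close>
  have "(2 * w + 1)^2 + 3 = 4 * (w^2 + w + 1)"
    by (simp add: algebra_simps power2_eq_square)
  moreover have "(3 :: 'a alg_closure) \<noteq> 0"
    using three_neq_zero[OF q] by (metis to_ac_numeral to_ac_eq_0_iff)
  ultimately have "2 * w + 1 \<noteq> 0"
    unfolding w by auto
  then have D: "v * (2 * w + 1) \<noteq> 0"
    using \<open>v \<noteq> 0\<close> by simp
  have diff: "y - y' = v * (2 * w + 1)"
    unfolding y_def y'_def v_def T.conj_y_def T'.conj_y_def by (simp add: w'_def algebra_simps)
  then have "y \<noteq> y'"
    using D by auto
  have "2 * w' + 1 = - (2 * w + 1)"
    unfolding w'_def by simp
  then have D': "v * (2 * w' + 1) \<noteq> 0"
    using D by (metis minus_mult_right neg_equal_0_iff_equal)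
  have "2 * y + a1 (closure_curve E) * x + a3 (closure_curve E) = y - y'"
    unfolding diff unfolding x_def y_def v_def by (rule T.conj_denominator)
  then have opp: "y + y' + a1 (closure_curve E) * x + a3 (closure_curve E) = 0"
    by (simp add: algebra_simps)
  then have opp': "y' + y + a1 (closure_curve E) * x + a3 (closure_curve E) = 0"
    by (simp only: add.commute[of y'])
  have neg: "- y - a1 (closure_curve E) * x - a3 (closure_curve E) = y'"
    "- y' - a1 (closure_curve E) * x - a3 (closure_curve E) = y"
    by (fact opp[unfolded opposite_ordinate_iff, symmetric] opp'[unfolded opposite_ordinate_iff, symmetric])+
  define H where "H = {Infinity, Affine x y, Affine x y'}"
  have "subgroup H (geometric_group E)"
    unfolding H_def
  proof (rule subgroup_order_three)
    show "on_curve (closure_curve E) x y" "on_curve (closure_curve E) x y'"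
      unfolding x_def y_def y'_def by (fact T.on_curve_conj T'.on_curve_conj)+
    show "ec_add (closure_curve E) (Affine x y) (Affine x y) = Affine x y'"
      using T.double_conj[folded v_def x_def y_def, OF D] unfolding neg .
    show "ec_add (closure_curve E) (Affine x y') (Affine x y') = Affine x y"
      using T'.double_conj[folded v_def x_def y'_def, OF D'] unfolding neg .
  qed (fact opp)
  moreover have frob: "frobenius (Affine x y) = Affine x y'" "frobenius (Affine x y') = Affine x y"
  proof -
    have x: "x ^ CARD('a) = x"
      using to_ac_power_card[of "x0 + 3 * m"] unfolding x_def T.conj_x_def by simp
    \<comment> \<open>The ordinates are split into base field coefficients, fixed by Frobenius, and
      the roots \<open>w\<close> and \<open>w'\<close>, which it swaps.\<close>
    define a b where "a = y0 + 3 * l * m - m * A" and "b = m * (A + 3 * k)"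
    have "y = to_ac a + to_ac b * w" "y' = to_ac a + to_ac b * w'"
      unfolding y_def y'_def T.conj_y_def T'.conj_y_def T.conj_v_def a_def b_def by simp_all
    moreover have "w ^ CARD('a) = w'" "w' ^ CARD('a) = w"
      using primitive_cube_root_power[OF w q] primitive_cube_root_power[OF w' q]
      by (simp_all add: w'_def)
    ultimately show "frobenius (Affine x y) = Affine x y'" "frobenius (Affine x y') = Affine x y"
      by (simp_all add: frobenius_Affine x frobenius_add power_mult_distrib to_ac_power_card)
  qed
  moreover have "frobenius Infinity = Infinity"
    by (simp add: frobenius_def)
  ultimately have "rational_subgroup E H"
    unfolding rational_subgroup_def by (auto simp: H_def)
  moreover have "card H = 3"
    using \<open>y \<noteq> y'\<close> by (simp add: H_def)
  moreover have nonrational: "\<forall>Q \<in> H - {Infinity}. Q \<notin> rational_points E"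
    using frob \<open>y \<noteq> y'\<close> by (auto simp: H_def dest: frobenius_rational_point)
  \<comment> \<open>\<open>P\<close> is a rational point other than \<open>Infinity\<close>, and
    \<open>H\<close> contains no such point.\<close>
  moreover have "P \<in> generate (geometric_group E) {P}"
    by (rule generate.incl) simp
  then have "H \<noteq> generate (geometric_group E) {P}"
    using nonrational assms(3) P by auto
  ultimately show ?thesis
    by blast
qed

end
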